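(* Let $n\ge2$ and let $c=p_1\cdots p_n$ be a product of distinct irregular primes. Then $\Lambda(c)$ has a solution only if there exists a set of strong friendly irregular pairs $S=\{(p_1,l_1),\ldots,(p_n,l_n)\}$. For each such set $S$ there is a unique integer $m_S$ with \[ c\le m_S-1\le \operatorname{lcm}(c,p_1-1,\ldots,p_n-1) \] which simultaneously solves the congruences \[ m_S-1\equiv p_\nu(l_\nu-1)\pmod{p_\nu(p_\nu-1)},\qquad \nu=1,\ldots,n. \] Moreover $\Lambda(c)=\min_S m_S$, where $S$ runs over all such sets of strong friendly irregular pairs.
   Context: $B_n$ denotes the $n$-th Bernoulli number ($\frac{z}{e^z-1}=\sum_{n\ge0}B_n\frac{z^n}{n!}$), $\operatorname{num}(r)$ the numerator of a rational number in lowest terms. For an odd prime $p$, $(p,l)$ is an irregular pair if $l$ is even, $2\le l\le p-3$ and $p\mid B_l$; $p$ is irregular if it has an irregular pair. For a positive integer $c$, $\Lambda(c)$ is the least even integer $m\ge2$ such that $\operatorname{num}(B_m/m)\big/\operatorname{num}(B_m/(m(m-1)))\equiv0\pmod c$, with $\Lambda(c)=\infty$ (no solution) if no such $m$ exists. Irregular pairs $(p_1,l_1),\ldots,(p_n,l_n)$ are friendly if $l_i\equiv l_j\pmod{\gcd(p_i-1,p_j-1)}$ for all $i\neq j$; they are strong friendly if, in addition, for all $i\neq j$ either $p_i\not\equiv1\pmod{p_j}$ or both $p_i\equiv1$ and $l_i\equiv1\pmod{p_j}$. *)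

theory Defs
  imports "HOL-Computational_Algebra.Computational_Algebra" "HOL-Number_Theory.Number_Theory"
    "HOL-Library.Extended_Nat"
begin

definition bernoulli :: "nat \<Rightarrow> rat" where
  "bernoulli n = fact n * fps_nth (fps_X / (fps_exp 1 - 1)) n"

definition num :: "rat \<Rightarrow> int" where
  "num r = fst (quotient_of r)"

definition irregular_pair :: "nat \<Rightarrow> nat \<Rightarrow> bool" where
  "irregular_pair p l \<longleftrightarrow> prime p \<and> odd p \<and> even l \<and> 2 \<le> l \<and> l + 3 \<le> p
     \<and> int p dvd num (bernoulli l)"

definition irregular_prime :: "nat \<Rightarrow> bool" where
  "irregular_prime p \<longleftrightarrow> (\<exists>l. irregular_pair p l)"

definition lambda_cond :: "nat \<Rightarrow> nat \<Rightarrow> bool" where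
  "lambda_cond c m \<longleftrightarrow> even m \<and> 2 \<le> m \<and>
     [num (bernoulli m / of_nat m) div num (bernoulli m / (of_nat m * (of_nat m - 1))) = 0] (mod int c)"

definition Lambda :: "nat \<Rightarrow> enat" where
  "Lambda c = (if \<exists>m. lambda_cond c m then enat (LEAST m. lambda_cond c m) else \<infinity>)"

text \<open>A set S of irregular pairs, one for each prime p in P, is given by l : P -> nat.\<close>
definition friendly :: "nat set \<Rightarrow> (nat \<Rightarrow> nat) \<Rightarrow> bool" where
  "friendly P l \<longleftrightarrow> (\<forall>p\<in>P. \<forall>q\<in>P. p \<noteq> q \<longrightarrow> [l p = l q] (mod gcd (p - 1) (q - 1)))"

definition strong_friendly :: "nat set \<Rightarrow> (nat \<Rightarrow> nat) \<Rightarrow> bool" where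
  "strong_friendly P l \<longleftrightarrow> friendly P l \<and>
     (\<forall>p\<in>P. \<forall>q\<in>P. p \<noteq> q \<longrightarrow>
        (\<not> [p = 1] (mod q) \<or> ([p = 1] (mod q) \<and> [l p = 1] (mod q))))"

definition strong_friendly_irregular :: "nat set \<Rightarrow> (nat \<Rightarrow> nat) \<Rightarrow> bool" where
  "strong_friendly_irregular P l \<longleftrightarrow> (\<forall>p\<in>P. irregular_pair p (l p)) \<and> strong_friendly P l"

definition mS_cond :: "nat set \<Rightarrow> (nat \<Rightarrow> nat) \<Rightarrow> nat \<Rightarrow> bool" where
  "mS_cond P l m \<longleftrightarrow> 1 \<le> m \<and> \<Prod>P \<le> m - 1 \<and> m - 1 \<le> lcm (\<Prod>P) (Lcm ((\<lambda>p. p - 1) ` P)) \<and>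
     (\<forall>p\<in>P. [m - 1 = p * (l p - 1)] (mod p * (p - 1)))"

end

theory Submission
  imports Defs
begin

text \<open>Since \<open>B\<^sub>m \<noteq> 0\<close> for even \<open>m\<close>, the ratio of the two numerators is the gcd of the numerator of
  \<open>B\<^sub>m / m\<close> and \<open>m - 1\<close>. If \<open>p\<close> divides \<open>m - 1\<close> then \<open>p\<close> does not divide \<open>m\<close>, so only the numerator of
  \<open>B\<^sub>m\<close> matters. Power sums give the von Staudt congruence, which excludes \<open>p - 1\<close> dividing \<open>m\<close>, and
  show that otherwise \<open>p\<close> divides the numerator of \<open>B\<^sub>m\<close> iff \<open>p\<^sup>2\<close> divides \<open>\<Sum>a<p. a ^ m\<close>. By Voronoi's
  congruence the latter depends only on \<open>m\<close> modulo \<open>p - 1\<close> as long as \<open>p\<close> does not divide \<open>m\<close>. Hence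
  \<open>p\<close> divides the ratio iff \<open>m - 1\<close> is 0 modulo \<open>p\<close> and \<open>l - 1\<close> modulo \<open>p - 1\<close> for some irregular pair
  \<open>(p, l)\<close>. Strong friendliness is exactly the compatibility of these congruences for the pairwise
  non-coprime moduli \<open>p\<close> and \<open>p - 1\<close>; a solution \<open>m - 1\<close> is a multiple of \<open>c\<close>, and it is nonzero
  because it is odd, so the least positive solution lies in the stated interval.\<close>

section \<open>Power sums and Bernoulli numbers modulo prime powers\<close>

text \<open>The divisor e^X - 1 has subdegree 1, so it divides X exactly and the quotient in the
  definition becomes a product identity.\<close>

lemma bernoulli_fps:
  "Abs_fps (\<lambda>n. bernoulli n / fact n) * (fps_exp 1 - 1) = (fps_X :: rat fps)"
proof -
  let ?g = "fps_exp 1 - 1 :: rat fps"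
  have "?g $ 0 = 0" "?g $ 1 = 1" by simp_all
  hence "subdegree ?g = 1" by (intro subdegreeI) auto
  moreover from this have "?g \<noteq> 0" by auto
  ultimately have "?g dvd fps_X" by (simp add: fps_dvd_iff)
  moreover have "Abs_fps (\<lambda>n. bernoulli n / fact n) = fps_X / ?g"
    by (rule fps_ext) (simp add: bernoulli_def)
  ultimately show ?thesis by simp
qed

text \<open>Multiplying the geometric series \<open>?E\<close> by e^X - 1 telescopes it to e^(nX) -
  1, and \<open>bernoulli_fps\<close> trades that factor for X. The claim is then the coefficient of
  X^(m+1).\<close>

lemma power_sum_bernoulli:
  "(\<Sum>a<n. of_nat a ^ m) =
   (\<Sum>i\<le>m. of_nat (m choose i) * bernoulli i * of_nat n ^ (m + 1 - i) / of_nat (m + 1 - i))"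
proof -
  let ?B = "Abs_fps (\<lambda>n. bernoulli n / fact n)"
  let ?E = "\<Sum>a<n. fps_exp (of_nat a) :: rat fps"
  have "(fps_exp 1 - 1) * ?E = fps_exp (of_nat n) - (1 :: rat fps)"
    using power_diff_1_eq[of "fps_exp (1::rat)" n] by (simp add: fps_exp_power_mult)
  hence "?B * (fps_exp (of_nat n) - 1) = fps_X * ?E"
    by (metis bernoulli_fps mult.assoc)
  hence "(fps_X * ?E) $ (Suc m) = (?B * (fps_exp (of_nat n) - 1)) $ Suc m"
    by simp
  also have "\<dots> = (\<Sum>i\<le>m. bernoulli i / fact i * (of_nat n ^ (m + 1 - i) / fact (m + 1 - i)))"
    by (simp add: fps_mult_nth atLeast0AtMost) (simp add: mult.commute)
  finally have "(\<Sum>a<n. of_nat a ^ m / fact m) =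
      (\<Sum>i\<le>m. bernoulli i / fact i * (of_nat n ^ (m + 1 - i) / fact (m + 1 - i)))"
    by (simp add: fps_sum_nth)
  hence "(\<Sum>a<n. of_nat a ^ m) =
      fact m * (\<Sum>i\<le>m. bernoulli i / fact i * (of_nat n ^ (m + 1 - i) / fact (m + 1 - i)))"
    by (simp add: field_simps flip: sum_divide_distrib)
  also have "\<dots> = (\<Sum>i\<le>m. of_nat (m choose i) * bernoulli i * of_nat n ^ (m + 1 - i) / of_nat (m + 1 - i))"
    unfolding sum_distrib_left
    by (intro sum.cong) (auto simp: binomial_fact Suc_diff_le field_simps)
  finally show ?thesis .
qed

section \<open>The localization of the integers at p\<close>

text \<open>The product form avoids division; b is nonzero automatically, as p divides 0.\<close>

definition p_integral :: "nat \<Rightarrow> rat \<Rightarrow> bool" where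
  "p_integral p r \<longleftrightarrow> (\<exists>a b. \<not> int p dvd b \<and> r * of_int b = of_int a)"

lemma p_integral_of_int [simp]: "prime p \<Longrightarrow> p_integral p (of_int a)"
  unfolding p_integral_def by (intro exI[of _ a] exI[of _ 1]) (auto dest: prime_gt_1_nat)

lemma p_integral_of_nat [simp]: "prime p \<Longrightarrow> p_integral p (of_nat a)"
  using p_integral_of_int[of p "int a"] by simp

lemma p_integral_mult:
  assumes "prime p" "p_integral p r" "p_integral p s"
  shows "p_integral p (r * s)"
proof -
  from assms(2,3) obtain a b a' b' where *: "\<not> int p dvd b" "r * of_int b = of_int a"
    "\<not> int p dvd b'" "s * of_int b' = of_int a'"
    unfolding p_integral_def by blast
  have "\<not> int p dvd b * b'"
    using * assms(1) by (simp add: prime_dvd_mult_iff)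
  moreover have "(r * s) * of_int (b * b') = of_int (a * a')"
    unfolding of_int_mult *(2,4)[symmetric] by (simp add: mult_ac)
  ultimately show ?thesis unfolding p_integral_def by blast
qed

lemma p_integral_add:
  assumes "prime p" "p_integral p r" "p_integral p s"
  shows "p_integral p (r + s)"
proof -
  from assms(2,3) obtain a b a' b' where *: "\<not> int p dvd b" "r * of_int b = of_int a"
    "\<not> int p dvd b'" "s * of_int b' = of_int a'"
    unfolding p_integral_def by blast
  have "\<not> int p dvd b * b'"
    using * assms(1) by (simp add: prime_dvd_mult_iff)
  moreover have "(r + s) * of_int (b * b') = of_int (a * b' + a' * b)"
    unfolding of_int_mult of_int_add *(2,4)[symmetric] by (simp add: algebra_simps)
  ultimately show ?thesis unfolding p_integral_def by blast
qed

lemma p_integral_diff: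
  assumes "prime p" "p_integral p r" "p_integral p s"
  shows "p_integral p (r - s)"
  using p_integral_add[OF assms(1,2) p_integral_mult[OF assms(1) p_integral_of_int[of p "-1"] assms(3)]]
    assms(1) by simp

lemma p_integral_sum:
  assumes "prime p" "\<And>i. i \<in> A \<Longrightarrow> p_integral p (f i)"
  shows "p_integral p (sum f A)"
  using assms(2)
proof (induction A rule: infinite_finite_induct)
  case (insert x A)
  then show ?case by (auto intro: p_integral_add assms(1))
qed (use p_integral_of_nat[OF assms(1), of 0] in auto)

lemma p_integral_int_over_p:
  assumes "prime p"
  shows "p_integral p (of_int a / of_nat (p ^ k)) \<longleftrightarrow> int p ^ k dvd a"
proof
  assume "int p ^ k dvd a"
  then obtain b where "a = int p ^ k * b" by blast
  hence "of_int a / of_nat (p ^ k) = (of_int b :: rat)"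
    using assms by (auto simp: prime_gt_0_nat)
  thus "p_integral p (of_int a / of_nat (p ^ k))"
    using assms by simp
next
  assume "p_integral p (of_int a / of_nat (p ^ k))"
  then obtain x y where xy: "\<not> int p dvd y" "of_int a / of_nat (p ^ k) * of_int y = (of_int x :: rat)"
    unfolding p_integral_def by blast
  have "of_int (a * y) = (of_int (x * int p ^ k) :: rat)"
    using xy(2) assms by (auto simp: field_simps prime_gt_0_nat)
  hence "a * y = x * int p ^ k" by (simp only: of_int_eq_iff)
  hence "int p ^ k dvd a * y" by simp
  moreover have "coprime (int p ^ k) y"
    using xy(1) assms by (simp add: prime_imp_coprime)
  ultimately show "int p ^ k dvd a"
    by (simp add: coprime_dvd_mult_left_iff)
qed

text \<open>Since p^v divides n, where v is the multiplicity of p in n, the size bound forces v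
  \<le> j. So the p-free part \<open>n'\<close> of n serves as a denominator.\<close>

lemma p_integral_prime_power_div:
  assumes "prime p" "0 < n" "n < p ^ Suc j"
  shows "p_integral p (of_nat (p ^ j) / of_nat n)"
proof -
  define n' where "n' = n div p ^ multiplicity p n"
  have n': "n = p ^ multiplicity p n * n'" "\<not> p dvd n'"
    using assms multiplicity_decompose[of n p] prime_gt_1_nat[OF assms(1)]
    by (auto simp: n'_def multiplicity_dvd)
  let ?v = "multiplicity p n"
  have "p ^ ?v \<le> n" using assms(2) by (simp add: dvd_imp_le multiplicity_dvd)
  hence "p ^ ?v < p ^ Suc j" using assms(3) by linarith
  hence "?v < Suc j" by (rule power_less_imp_less_exp[OF prime_gt_1_nat[OF assms(1)]])
  hence v: "?v \<le> j" by simp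
  have "n' \<noteq> 0" using n'(2) by (intro notI) simp
  have "of_nat (p ^ j) * of_nat n' = (of_nat (p ^ (j - ?v) * n) :: rat)"
    by (subst (2) n'(1)) (use v in \<open>simp add: mult_ac flip: power_add of_nat_mult of_nat_power\<close>)
  hence "of_nat (p ^ j) / of_nat n * of_int (int n') = (of_int (int (p ^ (j - ?v))) :: rat)"
    using assms(2) by (simp add: field_simps)
  moreover have "\<not> int p dvd int n'" using n'(2) by simp
  ultimately show ?thesis unfolding p_integral_def by blast
qed

lemma prime_dvd_num_iff:
  assumes "prime p"
  shows "int p dvd num r \<longleftrightarrow> p_integral p (r / of_nat p)"
proof -
  obtain a b where ab: "quotient_of r = (a, b)" by force
  have b: "b > 0" "coprime a b" "r = of_int a / of_int b"
    using ab quotient_of_denom_pos quotient_of_coprime quotient_of_div by blast+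
  have p0: "(of_nat p :: rat) \<noteq> 0" using assms by (simp add: prime_gt_0_nat)
  have "int p dvd a \<longleftrightarrow> p_integral p (r / of_nat p)"
  proof
    assume "int p dvd a"
    then obtain a' where a': "a = int p * a'" by blast
    have "\<not> int p dvd b"
      using b(2) \<open>int p dvd a\<close> assms by (meson coprime_common_divisor not_prime_unit prime_nat_int_transfer)
    moreover have "r / of_nat p * of_int b = of_int a'"
      using b(1,3) p0 a' by simp
    ultimately show "p_integral p (r / of_nat p)" unfolding p_integral_def by blast
  next
    assume "p_integral p (r / of_nat p)"
    hence "p_integral p (r / of_nat p * of_int b)"
      by (intro p_integral_mult assms p_integral_of_int)
    thus "int p dvd a" using b(1,3) p_integral_int_over_p[OF assms, of a 1] by simp
  qed
  thus ?thesis by (simp add: num_def ab)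
qed

section \<open>Power sums compared with Bernoulli numbers\<close>

text \<open>The term i = m of \<open>power_sum_bernoulli\<close> is p * B_m. The others are grouped
  as p * B_i, which turns out p-integral for odd p, times p^k / (k + 1) with k = m - i, which
  supplies powers of p.\<close>

lemma power_sum_minus_bernoulli:
  "(\<Sum>a<p. of_nat a ^ m) - of_nat p * bernoulli m =
    (\<Sum>i<m. of_nat (m choose i) * (of_nat p * bernoulli i) * (of_nat (p ^ (m - i)) / of_nat (m + 1 - i)))"
  unfolding power_sum_bernoulli lessThan_Suc_atMost[symmetric]
  by (simp add: Suc_diff_le mult_ac)

lemma power_sum_bernoulli_p_integral:
  assumes "prime p" "\<And>i. i < m \<Longrightarrow> p_integral p (of_nat (m choose i) * (of_nat p * bernoulli i) *
      (of_nat (p ^ (m - i)) / of_nat (m + 1 - i)) / of_nat (p ^ s))"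
  shows "p_integral p (((\<Sum>a<p. of_nat a ^ m) - of_nat p * bernoulli m) / of_nat (p ^ s))"
  unfolding power_sum_minus_bernoulli sum_divide_distrib
  using assms by (intro p_integral_sum) auto

lemma Suc_less_power_odd:
  assumes "p \<ge> (3::nat)" "k > 0"
  shows "k + 1 < p ^ k"
  using assms(2)
proof (induction k rule: nat_induct_non_zero)
  case (Suc k)
  have "Suc k + 1 < 2 * (k + 1)" using Suc by simp
  also have "\<dots> < 2 * p ^ k" using Suc by simp
  also have "\<dots> \<le> p ^ Suc k" using assms(1) by simp
  finally show ?case .
qed (use assms in auto)

text \<open>The size condition of \<open>p_integral_power_div_Suc\<close> for s = 2, as
  \<open>Suc_less_power_odd\<close> is for s = 1. At k = 2 it reads 3 < p, which excludes p =
  3.\<close>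

lemma Suc_less_power_pred:
  assumes "p \<ge> (5::nat)" "k \<ge> 2"
  shows "k + 1 < p ^ (k - 1)"
  using assms(2)
proof (induction k rule: nat_induct_at_least)
  case (Suc k)
  have "Suc k + 1 < 2 * (k + 1)" using Suc by simp
  also have "\<dots> < 2 * p ^ (k - 1)" using Suc by simp
  also have "\<dots> \<le> p * p ^ (k - 1)" using assms(1) by simp
  also have "\<dots> = p ^ (Suc k - 1)" using Suc by (cases k) auto
  finally show ?case .
qed (use assms in auto)

lemma p_integral_power_div_Suc:
  assumes "prime p" "s \<le> k" "k + 1 < p ^ (k - s + 1)"
  shows "p_integral p (of_nat (p ^ k) / of_nat (k + 1) / of_nat (p ^ s))"
proof -
  have "p_integral p (of_nat (p ^ (k - s)) / of_nat (k + 1))"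
    by (rule p_integral_prime_power_div) (use assms in auto)
  also have "(of_nat (p ^ (k - s)) :: rat) = of_nat (p ^ k) / of_nat (p ^ s)"
    using assms by (simp add: field_simps prime_gt_0_nat flip: power_add)
  finally show ?thesis by (simp add: mult.commute)
qed

text \<open>The third hypothesis is the induction hypothesis of
  \<open>p_integral_p_bernoulli\<close>, which afterwards discharges it.\<close>

lemma power_sum_cong_mod_p:
  assumes "prime p" "p \<ge> 3" "\<And>i. i < m \<Longrightarrow> p_integral p (of_nat p * bernoulli i)"
  shows "p_integral p (((\<Sum>a<p. of_nat a ^ m) - of_nat p * bernoulli m) / of_nat p)"
proof -
  have "p_integral p (of_nat (m choose i) * (of_nat p * bernoulli i) *
      (of_nat (p ^ (m - i)) / of_nat (m + 1 - i)) / of_nat (p ^ 1))" if "i < m" for i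
  proof -
    have "p_integral p (of_nat (m choose i) * (of_nat p * bernoulli i) *
      (of_nat (p ^ (m - i)) / of_nat (m - i + 1) / of_nat (p ^ 1)))"
    proof (intro p_integral_mult[OF assms(1) p_integral_mult[OF assms(1) _ assms(3)]]
        p_integral_power_div_Suc p_integral_of_nat)
      have "m - i - 1 + 1 = m - i" using that by simp
      thus "m - i + 1 < p ^ (m - i - 1 + 1)"
        using Suc_less_power_odd[OF assms(2), of "m - i"] that by presburger
    qed (use that assms in auto)
    thus ?thesis using that by (simp add: Suc_diff_le)
  qed
  from power_sum_bernoulli_p_integral[OF assms(1) this] show ?thesis by simp
qed

text \<open>By strong induction: p * B_m is an integer power sum minus p times a quotient that is
  p-integral by \<open>power_sum_cong_mod_p\<close>.\<close>

lemma p_integral_p_bernoulli: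
  assumes "prime p" "p \<ge> 3"
  shows "p_integral p (of_nat p * bernoulli m)"
proof (induction m rule: less_induct)
  case (less m)
  let ?S = "\<Sum>a<p. of_nat a ^ m :: rat"
  have "p_integral p (?S - of_nat p * ((?S - of_nat p * bernoulli m) / of_nat p))"
    using assms less power_sum_cong_mod_p[OF assms less]
    by (intro p_integral_diff p_integral_mult p_integral_sum) (auto simp flip: of_nat_power)
  thus ?case using assms by simp
qed

definition power_sum :: "nat \<Rightarrow> nat \<Rightarrow> int" where
  "power_sum p m = (\<Sum>a<p. int a ^ m)"

lemma p_integral_bernoulli_iff:
  assumes "prime p" "p \<ge> 3"
  shows "p_integral p (bernoulli m) \<longleftrightarrow> int p dvd power_sum p m"
proof -
  have p0: "(of_nat p :: rat) \<noteq> 0" using assms by simp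
  let ?S = "of_int (power_sum p m) :: rat"
  have *: "p_integral p ((?S - of_nat p * bernoulli m) / of_nat p)"
    using power_sum_cong_mod_p[OF assms p_integral_p_bernoulli[OF assms], of m] by (simp add: power_sum_def)
  have "p_integral p (bernoulli m) \<longleftrightarrow> p_integral p (?S / of_nat p)"
    using p_integral_add[OF assms(1) *, of "bernoulli m"]
      p_integral_diff[OF assms(1) _ *, of "?S / of_nat p"] p0
    by (auto simp: diff_divide_distrib)
  thus ?thesis using p_integral_int_over_p[OF assms(1), of "power_sum p m" 1] by simp
qed

section \<open>Power sums modulo p and Voronoi's congruence\<close>

text \<open>Fermat settles bases prime to p. Positive exponents are for the multiples of p, where
  0^0 = 1 would break the congruence.\<close>

lemma pow_cong_mod_prime:
  assumes "prime p" "[m = l] (mod p - 1)" "m > 0" "l > 0"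
  shows "[int a ^ m = int a ^ l] (mod int p)"
proof -
  have "[a ^ m = a ^ l] (mod p)"
  proof (cases "p dvd a")
    case True
    hence "p dvd a ^ m" "p dvd a ^ l" using assms by (auto intro: dvd_trans dvd_power)
    thus ?thesis by (simp add: cong_def mod_eq_0_iff_dvd)
  next
    case False
    hence "coprime p a" using assms(1) by (simp add: prime_imp_coprime)
    moreover have "ord p a dvd p - 1"
      using fermat_theorem[OF assms(1) False] by (simp only: ord_divides)
    ultimately show ?thesis using assms(2) by (simp add: order_divides_expdiff cong_dvd_modulus_nat)
  qed
  thus ?thesis by (simp flip: cong_int_iff)
qed

lemma power_sum_of_dvd:
  assumes "prime p" "p - 1 dvd m" "m > 0"
  shows "[power_sum p m = -1] (mod int p)"
proof -
  have m: "[m = p - 1] (mod p - 1)" "p - 1 > 0"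
    using assms prime_gt_1_nat[of p] by (auto simp: cong_def)
  have *: "{..<p} = insert 0 {1..<p}" using prime_gt_0_nat[OF assms(1)] by auto
  have "[(\<Sum>a\<in>{1..<p}. int a ^ m) = (\<Sum>a\<in>{1..<p}. 1)] (mod int p)"
  proof (rule cong_sum)
    fix a assume "a \<in> {1..<p}"
    hence "\<not> p dvd a" by (auto dest: dvd_imp_le)
    hence "[a ^ (p - 1) = 1] (mod p)" by (rule fermat_theorem[OF assms(1)])
    hence "[int a ^ (p - 1) = 1] (mod int p)" by (metis cong_int_iff of_nat_1 of_nat_power)
    thus "[int a ^ m = 1] (mod int p)"
      using pow_cong_mod_prime[OF assms(1) m(1) assms(3) m(2), of a] cong_trans by blast
  qed
  hence "[power_sum p m = int (p - 1)] (mod int p)"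
    using assms(3) by (simp add: power_sum_def * zero_power)
  also have "int (p - 1) = -1 + int p" using prime_gt_0_nat[OF assms(1)] by simp
  also have "[-1 + int p = -1] (mod int p)" by (simp add: cong_def)
  finally show ?thesis .
qed

lemma power_add_mult_cong:
  assumes "m > 0"
  shows "[(x + p * y) ^ m = x ^ m + of_nat m * x ^ (m - 1) * (p * y)] (mod p ^ 2 :: int)"
  using assms
proof (induction m rule: nat_induct_non_zero)
  case (Suc m)
  have "[(x + p * y) * (x + p * y) ^ m = (x + p * y) * (x ^ m + of_nat m * x ^ (m - 1) * (p * y))] (mod p ^ 2)"
    by (rule cong_scalar_left) (rule Suc)
  also have "(x + p * y) * (x ^ m + of_nat m * x ^ (m - 1) * (p * y)) =
     x ^ Suc m + of_nat (Suc m) * x ^ (Suc m - 1) * (p * y) + p ^ 2 * (of_nat m * x ^ (m - 1) * y ^ 2)"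
    using Suc by (cases m) (auto simp: algebra_simps power2_eq_square)
  also have "[\<dots> = x ^ Suc m + of_nat (Suc m) * x ^ (Suc m - 1) * (p * y)] (mod p ^ 2)"
    by (simp add: cong_def)
  finally show ?case by simp
qed auto

text \<open>Multiplication by g permutes the residues modulo p. Writing g * a mod p as g * a - p *
  (g * a div p) and expanding the m-th power to first order in p compares the power sum with g^m
  times itself.\<close>

lemma voronoi_congruence:
  assumes "prime p" "\<not> p dvd g" "m > 0"
  shows "[(int g ^ m - 1) * power_sum p m =
     int p * (int m * int g ^ (m - 1) * (\<Sum>a<p. int a ^ (m - 1) * int (g * a div p)))] (mod int p ^ 2)"
proof -
  have cop: "coprime p g" using assms by (simp add: prime_imp_coprime)
  have "inj_on (\<lambda>a. g * a mod p) {..<p}"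
  proof (rule inj_onI)
    fix x y assume xy: "x \<in> {..<p}" "y \<in> {..<p}" "g * x mod p = g * y mod p"
    hence "[g * x = g * y] (mod p)" by (simp add: cong_def)
    hence "[x = y] (mod p)" using cop by (simp add: cong_mult_lcancel_nat coprime_commute)
    thus "x = y" using xy by (simp add: cong_less_modulus_unique_nat)
  qed
  moreover have "(\<lambda>a. g * a mod p) ` {..<p} \<subseteq> {..<p}"
    using assms(1) by (auto simp: prime_gt_0_nat)
  ultimately have bij: "bij_betw (\<lambda>a. g * a mod p) {..<p} {..<p}"
    unfolding bij_betw_def by (metis endo_inj_surj finite_lessThan)
  have "power_sum p m = (\<Sum>a<p. int (g * a mod p) ^ m)"
    unfolding power_sum_def by (rule sum.reindex_bij_betw[OF bij, symmetric])
  also have "[\<dots> = (\<Sum>a<p. int (g * a) ^ m + of_nat m * int (g * a) ^ (m - 1) * (int p * - int (g * a div p)))] (mod int p ^ 2)"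
  proof (rule cong_sum)
    fix a
    have "int (g * a) = int (g * a mod p) + int p * int (g * a div p)"
      by (metis add.commute mult_div_mod_eq of_nat_add of_nat_mult)
    hence "int (g * a mod p) = int (g * a) + int p * - int (g * a div p)"
      by simp
    thus "[int (g * a mod p) ^ m = int (g * a) ^ m + of_nat m * int (g * a) ^ (m - 1) * (int p * - int (g * a div p))] (mod int p ^ 2)"
      by (metis power_add_mult_cong[OF assms(3)])
  qed
  also have "(\<Sum>a<p. int (g * a) ^ m + of_nat m * int (g * a) ^ (m - 1) * (int p * - int (g * a div p))) =
     int g ^ m * power_sum p m - int p * (int m * int g ^ (m - 1) * (\<Sum>a<p. int a ^ (m - 1) * int (g * a div p)))"
    unfolding power_sum_def sum_distrib_left
    by (simp add: sum_subtractf[symmetric] power_mult_distrib mult_ac)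
  finally have "int p ^ 2 dvd - (power_sum p m - (int g ^ m * power_sum p m -
      int p * (int m * int g ^ (m - 1) * (\<Sum>a<p. int a ^ (m - 1) * int (g * a div p)))))"
    by (simp only: cong_iff_dvd_diff dvd_minus_iff)
  also have "\<dots> = (int g ^ m - 1) * power_sum p m -
      int p * (int m * int g ^ (m - 1) * (\<Sum>a<p. int a ^ (m - 1) * int (g * a div p)))"
    by (simp add: left_diff_distrib)
  finally show ?thesis
    by (simp only: cong_iff_dvd_diff)
qed

lemma exists_power_not_cong_1:
  assumes "prime p" "\<not> p - 1 dvd m"
  obtains g where "\<not> p dvd g" "\<not> int p dvd int g ^ m - 1"
proof -
  have "p \<noteq> 2" using assms(2) by auto
  hence "odd p" using assms(1) prime_ge_2_nat[OF assms(1)] by (intro prime_odd_nat) auto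
  then obtain g where g: "residue_primroot p g"
    using residue_primroot_odd_prime_power_exists[of p] assms(1) by (metis zero_less_one power_one_right residue_primroot_mod)
  hence "coprime p g" "ord p g = p - 1"
    using assms(1) by (auto simp: residue_primroot_def totient_prime)
  moreover have "\<not> p dvd g"
    using \<open>coprime p g\<close> assms(1) by (metis coprime_absorb_left not_prime_unit)
  moreover have "\<not> int p dvd int g ^ m - 1"
  proof
    assume "int p dvd int g ^ m - 1"
    hence "[int (g ^ m) = int 1] (mod int p)" by (simp add: cong_iff_dvd_diff)
    hence "[g ^ m = 1] (mod p)" by (simp only: cong_int_iff)
    thus False using assms(2) \<open>ord p g = p - 1\<close> by (simp only: ord_divides)
  qed
  ultimately show ?thesis using that by blast
qed

text \<open>Modulo p Voronoi's congruence reads (g^m - 1) * S = 0, and a primitive root makes the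
  first factor a unit unless p - 1 divides m. In that remaining case the sum is -1.\<close>

lemma prime_dvd_power_sum_iff:
  assumes "prime p" "m > 0"
  shows "int p dvd power_sum p m \<longleftrightarrow> \<not> p - 1 dvd m"
proof
  assume "\<not> p - 1 dvd m"
  then obtain g where g: "\<not> p dvd g" "\<not> int p dvd int g ^ m - 1"
    using exists_power_not_cong_1 assms(1) by blast
  have "[(int g ^ m - 1) * power_sum p m =
     int p * (int m * int g ^ (m - 1) * (\<Sum>a<p. int a ^ (m - 1) * int (g * a div p)))] (mod int p)"
    using voronoi_congruence[OF assms(1) g(1) assms(2)] by (rule cong_dvd_modulus) simp
  hence "int p dvd (int g ^ m - 1) * power_sum p m"
    using cong_dvd_iff by fastforce
  thus "int p dvd power_sum p m" using g(2) assms(1) by (simp add: prime_dvd_mult_iff)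
next
  assume "int p dvd power_sum p m"
  show "\<not> p - 1 dvd m"
  proof
    assume "p - 1 dvd m"
    hence "[power_sum p m = -1] (mod int p)" using power_sum_of_dvd assms by blast
    hence "int p dvd -1" using \<open>int p dvd power_sum p m\<close> cong_dvd_iff by blast
    thus False using prime_gt_1_nat[OF assms(1)] by simp
  qed
qed

lemma p_integral_bernoulli_iff_not_dvd:
  assumes "prime p" "p \<ge> 3" "m > 0"
  shows "p_integral p (bernoulli m) \<longleftrightarrow> \<not> p - 1 dvd m"
  using assms by (simp add: p_integral_bernoulli_iff prime_dvd_power_sum_iff)

text \<open>The von Staudt congruence at the single prime 3 suffices, as 3 - 1 divides every even index.
  The ratio of numerators in \<^const>\<open>lambda_cond\<close> would be the junk value 0 div 0 = 0 at a vanishing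
  Bernoulli number.\<close>
lemma bernoulli_even_nonzero:
  assumes "even m" "m > 0"
  shows "bernoulli m \<noteq> 0"
proof
  assume "bernoulli m = 0"
  hence "p_integral 3 (bernoulli m)" using p_integral_of_nat[of 3 0] by simp
  thus False using p_integral_bernoulli_iff_not_dvd[of 3 m] assms by simp
qed

text \<open>For k = m - i \<ge> 2 the factor p^k / (k + 1) absorbs p^2. For i = m - 1 it gives only
  one p, but i is odd while p - 1 is even, so B_i itself is p-integral and the p of p * B_i is the
  second.\<close>

lemma power_sum_cong_mod_p_squared:
  assumes "prime p" "p \<ge> 5" "even m" "m > 0"
  shows "p_integral p ((of_int (power_sum p m) - of_nat p * bernoulli m) / of_nat (p ^ 2))"
proof -
  have p0: "(of_nat p :: rat) \<noteq> 0" using assms by simp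
  have "p_integral p (of_nat (m choose i) * (of_nat p * bernoulli i) *
      (of_nat (p ^ (m - i)) / of_nat (m + 1 - i)) / of_nat (p ^ 2))" if "i < m" for i
  proof (cases "i + 1 = m")
    case True
    have "odd p" using assms(1,2) by (intro prime_odd_nat) auto
    hence "even (p - 1)" "odd i" using assms(3) True by auto
    hence "\<not> p - 1 dvd i" "i > 0" using dvd_trans by (blast, auto intro: Nat.gr0I)
    hence "p_integral p (bernoulli i)" using assms by (simp add: p_integral_bernoulli_iff_not_dvd)
    hence "p_integral p (of_nat (m choose i) * bernoulli i * (of_nat (p ^ 1) / of_nat (1 + 1) / of_nat (p ^ 1)))"
      using assms by (intro p_integral_mult p_integral_power_div_Suc p_integral_of_nat) auto
    thus ?thesis using p0 True by (simp add: power2_eq_square mult_ac Suc_diff_le flip: True)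
  next
    case False
    hence k: "m - i \<ge> 2" using that by simp
    have "p_integral p (of_nat (m choose i) * (of_nat p * bernoulli i) *
      (of_nat (p ^ (m - i)) / of_nat (m - i + 1) / of_nat (p ^ 2)))"
    proof (intro p_integral_mult[OF assms(1) p_integral_mult[OF assms(1) _ p_integral_p_bernoulli]]
        p_integral_power_div_Suc p_integral_of_nat)
      have "m - i - 2 + 1 = m - i - 1" using k by simp
      thus "m - i + 1 < p ^ (m - i - 2 + 1)"
        using Suc_less_power_pred[OF assms(2) k] by presburger
    qed (use k assms in auto)
    thus ?thesis using that by (simp add: Suc_diff_le)
  qed
  from power_sum_bernoulli_p_integral[OF assms(1) this] show ?thesis by (simp add: power_sum_def)
qed

lemma prime_dvd_num_bernoulli_iff:
  assumes "prime p" "p \<ge> 5" "even m" "m > 0"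
  shows "int p dvd num (bernoulli m) \<longleftrightarrow> int p ^ 2 dvd power_sum p m"
proof -
  have p0: "(of_nat p :: rat) \<noteq> 0" using assms by simp
  let ?S = "of_int (power_sum p m) :: rat"
  let ?d = "(?S - of_nat p * bernoulli m) / of_nat (p ^ 2)"
  note * = power_sum_cong_mod_p_squared[OF assms]
  have eq: "?S / of_nat (p ^ 2) = bernoulli m / of_nat p + ?d"
    using p0 by (simp add: field_simps power2_eq_square)
  hence eq': "bernoulli m / of_nat p = ?S / of_nat (p ^ 2) - ?d" by simp
  have "p_integral p (bernoulli m / of_nat p) \<longleftrightarrow> p_integral p (?S / of_nat (p ^ 2))"
    using p_integral_add[OF assms(1) _ *] p_integral_diff[OF assms(1) _ *] eq eq' by metis
  thus ?thesis using assms(1) by (simp add: prime_dvd_num_iff p_integral_int_over_p flip: of_nat_power)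
qed

text \<open>Voronoi turns divisibility of the power sum by p^2 into divisibility of
  \<open>?V\<close> by p: g^m - 1, m and g are units modulo p, and one factor p cancels. In
  \<open>?V\<close> the exponent enters only through a^(m - 1), and Fermat applies because m - 1 >
  0.\<close>

lemma prime_squared_dvd_power_sum_cong:
  assumes "prime p" "[m = l] (mod p - 1)" "\<not> p - 1 dvd m" "m \<ge> 2" "l \<ge> 2" "\<not> p dvd m" "\<not> p dvd l"
  shows "int p ^ 2 dvd power_sum p m \<longleftrightarrow> int p ^ 2 dvd power_sum p l"
proof -
  obtain g where g: "\<not> p dvd g" "\<not> int p dvd int g ^ m - 1"
    using exists_power_not_cong_1 assms by blast
  let ?V = "\<lambda>m. \<Sum>a<p. int a ^ (m - 1) * int (g * a div p)"
  have p0: "int p \<noteq> 0" using assms(1) by auto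
  have key: "int p ^ 2 dvd power_sum p k \<longleftrightarrow> int p dvd ?V k"
    if "\<not> int p dvd int g ^ k - 1" "k > 0" "\<not> p dvd k" for k
  proof -
    have "coprime (int p ^ 2) (int g ^ k - 1)"
      using that(1) assms(1) by (simp add: prime_imp_coprime)
    hence "int p ^ 2 dvd power_sum p k \<longleftrightarrow> int p ^ 2 dvd (int g ^ k - 1) * power_sum p k"
      by (simp add: coprime_dvd_mult_right_iff)
    also have "\<dots> \<longleftrightarrow> int p ^ 2 dvd int p * (int k * int g ^ (k - 1) * ?V k)"
      by (rule cong_dvd_iff[OF voronoi_congruence[OF assms(1) g(1) that(2)]])
    also have "\<dots> \<longleftrightarrow> int p dvd int k * int g ^ (k - 1) * ?V k"
      using p0 by (simp add: power2_eq_square)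
    also have "\<dots> \<longleftrightarrow> int p dvd ?V k"
    proof -
      have "coprime (int p) (int k * int g ^ (k - 1))"
        using that(3) g(1) assms(1) by (auto simp: prime_imp_coprime)
      thus ?thesis by (simp add: coprime_dvd_mult_right_iff)
    qed
    finally show ?thesis .
  qed
  have "[int g ^ m - 1 = int g ^ l - 1] (mod int p)"
    using pow_cong_mod_prime[OF assms(1,2)] assms by (intro cong_diff) auto
  hence g': "\<not> int p dvd int g ^ l - 1" using g(2) cong_dvd_iff by blast
  have "[(m - 1) + 1 = (l - 1) + 1] (mod p - 1)" using assms by simp
  hence "[m - 1 = l - 1] (mod p - 1)" by (simp only: cong_add_rcancel_nat)
  hence "[?V m = ?V l] (mod int p)"
    using assms by (intro cong_sum cong_mult pow_cong_mod_prime cong_refl) auto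
  hence "int p dvd ?V m \<longleftrightarrow> int p dvd ?V l" by (rule cong_dvd_iff)
  thus ?thesis using key[of m] key[of l] g g' assms by auto
qed

section \<open>The ratio of numerators at a single prime\<close>

text \<open>For r = a / b in lowest terms, b is coprime to a and does not affect gcd a (b * k), so
  dividing r by k shortens the numerator exactly by gcd a k.\<close>

lemma num_div_num_divide:
  assumes "r \<noteq> 0" "k > 0"
  shows "num r div num (r / of_int k) = gcd (num r) k"
proof -
  obtain a b where ab: "quotient_of r = (a, b)" by force
  have b: "b > 0" "coprime a b" "r = of_int a / of_int b"
    using ab quotient_of_denom_pos quotient_of_coprime quotient_of_div by blast+
  have a0: "a \<noteq> 0" using b assms by auto
  have "r / of_int k = Rat.Fract a (b * k)"
    using b by (simp add: Fract_of_int_quotient)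
  hence "num (r / of_int k) = a div gcd a (b * k)"
    using b assms by (simp add: num_def quotient_of_Fract Rat.normalize_def Let_def)
  also have "gcd a (b * k) = gcd a k"
    using b(2) by (simp add: gcd_mult_right_left_cancel)
  finally have "num r div num (r / of_int k) = a div (a div gcd a k)"
    by (simp add: num_def ab)
  also have "a = gcd a k * (a div gcd a k)" by simp
  hence "a div (a div gcd a k) = gcd a k"
    using a0 by (metis mult_zero_right nonzero_mult_div_cancel_right)
  finally show ?thesis by (simp add: num_def ab)
qed

text \<open>The modulus splits into the coprime factors p and p - 1, and p is 1 modulo p -
  1.\<close>

lemma cong_pair_iff:
  fixes p l x :: nat
  assumes "prime p" "l > 0"
  shows "[x = p * (l - 1)] (mod p * (p - 1)) \<longleftrightarrow> p dvd x \<and> [x + 1 = l] (mod p - 1)"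
proof -
  have cop: "coprime p (p - 1)"
    using coprime_diff_one_left_nat prime_gt_0_nat[OF assms(1)] by (simp add: coprime_commute)
  have "p * (l - 1) = (l - 1) + (p - 1) * (l - 1)"
    using prime_gt_0_nat[OF assms(1)] by (cases p) auto
  hence "[p * (l - 1) = l - 1] (mod p - 1)" by (simp add: cong_def)
  hence "[x = p * (l - 1)] (mod p - 1) \<longleftrightarrow> [x = l - 1] (mod p - 1)"
    using cong_trans cong_sym by blast
  also have "\<dots> \<longleftrightarrow> [x + 1 = (l - 1) + 1] (mod p - 1)"
    by (simp only: cong_add_rcancel_nat)
  also have "(l - 1) + 1 = l" using assms by simp
  finally have 1: "[x = p * (l - 1)] (mod p - 1) \<longleftrightarrow> [x + 1 = l] (mod p - 1)" .
  have 2: "[x = p * (l - 1)] (mod p) \<longleftrightarrow> p dvd x"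
    by (simp add: cong_def mod_eq_0_iff_dvd)
  show ?thesis
  proof
    assume *: "[x = p * (l - 1)] (mod p * (p - 1))"
    hence "[x = p * (l - 1)] (mod p)" by (rule cong_dvd_modulus_nat) simp
    moreover from * have "[x = p * (l - 1)] (mod p - 1)" by (rule cong_dvd_modulus_nat) simp
    ultimately show "p dvd x \<and> [x + 1 = l] (mod p - 1)" using 1 2 by blast
  next
    assume "p dvd x \<and> [x + 1 = l] (mod p - 1)"
    hence "[x = p * (l - 1)] (mod p)" "[x = p * (l - 1)] (mod p - 1)" using 1 2 by blast+
    thus "[x = p * (l - 1)] (mod p * (p - 1))" using cop by (rule coprime_cong_mult_nat)
  qed
qed

lemma irregular_pair_ge_5: "irregular_pair p l \<Longrightarrow> p \<ge> 5"
  by (auto simp: irregular_pair_def)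

text \<open>Once p divides m - 1, the factor 1 / m is harmless at p, and divisibility of the
  numerator transfers between B_m and B_l for l congruent to m modulo p - 1. As 0 < l < p, the power
  sum criterion applies to l as well.\<close>

lemma prime_dvd_ratio_iff:
  assumes "prime p" "odd p" "even m" "m \<ge> 2"
  shows "int p dvd gcd (num (bernoulli m / of_nat m)) (int m - 1) \<longleftrightarrow>
    (\<exists>l. irregular_pair p l \<and> [m - 1 = p * (l - 1)] (mod p * (p - 1)))"
proof -
  have p3: "p \<ge> 3" using assms(1,2) prime_ge_2_nat[of p] by (cases "p = 2") auto
  have ndvd: "\<not> p dvd m" if "p dvd m - 1"
  proof
    assume "p dvd m"
    hence "p dvd m - (m - 1)" using that by (rule dvd_diff_nat)
    thus False using assms(1,4) not_prime_unit by simp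
  qed
  have num_iff: "int p dvd num (bernoulli m / of_nat m) \<longleftrightarrow> int p dvd num (bernoulli m)"
    if "\<not> p dvd m"
  proof -
    have m0: "(of_nat m :: rat) \<noteq> 0" using assms by simp
    have "p_integral p (1 / of_nat m)"
      unfolding p_integral_def using that m0 by (intro exI[of _ 1] exI[of _ "int m"]) auto
    hence "p_integral p (bernoulli m / of_nat m / of_nat p)" if "p_integral p (bernoulli m / of_nat p)"
      using p_integral_mult[OF assms(1) that, of "1 / of_nat m"] by (simp add: mult.commute)
    moreover have "p_integral p (bernoulli m / of_nat p)" if "p_integral p (bernoulli m / of_nat m / of_nat p)"
      using p_integral_mult[OF assms(1) that p_integral_of_nat[OF assms(1), of m]] m0 by simp
    ultimately show ?thesis using assms(1) by (auto simp: prime_dvd_num_iff)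
  qed
  have m1: "int p dvd int m - 1 \<longleftrightarrow> p dvd m - 1"
    using assms(4) by (metis int_dvd_int_iff of_nat_1 of_nat_diff one_le_numeral order_trans)
  show ?thesis
  proof
    assume "int p dvd gcd (num (bernoulli m / of_nat m)) (int m - 1)"
    hence pm1: "p dvd m - 1" and pB: "int p dvd num (bernoulli m)"
      using m1 num_iff ndvd by auto
    \<comment> \<open>A numerator divisible by p makes B_m p-integral, so von Staudt excludes that p
      - 1 divides m.\<close>
    have "p_integral p (bernoulli m / of_nat p * of_nat p)"
      using pB assms(1) by (intro p_integral_mult) (auto simp: prime_dvd_num_iff)
    hence "p_integral p (bernoulli m)" using p3 by simp
    hence nd: "\<not> p - 1 dvd m" using p_integral_bernoulli_iff_not_dvd[of p m] assms p3 by simp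
    \<comment> \<open>For p = 3 the even m would be a multiple of p - 1.\<close>
    have "p \<noteq> 3" "p \<noteq> 4" using nd assms by auto
    hence p5: "p \<ge> 5" using p3 by simp
    define l where "l = m mod (p - 1)"
    have "even (p - 1)" using assms by simp
    hence "even l" using assms unfolding l_def by (simp add: dvd_mod_iff)
    moreover have "l \<noteq> 0" using nd by (simp add: l_def mod_eq_0_iff_dvd)
    moreover have "l < p - 1" using p3 unfolding l_def by simp
    \<comment> \<open>Parity sharpens 0 < l < p - 1 to 2 \<le> l \<le> p - 3, the range of an
      irregular pair.\<close>
    moreover have "l \<noteq> 1" "l \<noteq> p - 2" using \<open>even l\<close> assms p3 by auto
    ultimately have l: "even l" "2 \<le> l" "l + 3 \<le> p" by linarith+
    have ml: "[m = l] (mod p - 1)" by (simp add: l_def cong_def)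
    have "\<not> p dvd l" using l by (auto dest: dvd_imp_le)
    hence "int p dvd num (bernoulli l)"
      using prime_squared_dvd_power_sum_cong[OF assms(1) ml nd assms(4) l(2) ndvd[OF pm1]]
        pB l assms p5 by (simp add: prime_dvd_num_bernoulli_iff)
    hence "irregular_pair p l" using assms l by (simp add: irregular_pair_def)
    moreover have "[m - 1 = p * (l - 1)] (mod p * (p - 1))"
      using cong_pair_iff[OF assms(1), of l "m - 1"] pm1 ml l assms by simp
    ultimately show "\<exists>l. irregular_pair p l \<and> [m - 1 = p * (l - 1)] (mod p * (p - 1))" by blast
  next
    assume "\<exists>l. irregular_pair p l \<and> [m - 1 = p * (l - 1)] (mod p * (p - 1))"
    then obtain l where l: "irregular_pair p l" "[m - 1 = p * (l - 1)] (mod p * (p - 1))" by blast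
    have l': "even l" "2 \<le> l" "l + 3 \<le> p" "int p dvd num (bernoulli l)"
      using l(1) by (auto simp: irregular_pair_def)
    have pm1: "p dvd m - 1" and ml: "[m = l] (mod p - 1)"
      using cong_pair_iff[OF assms(1), of l "m - 1"] l l' assms by auto
    have ndl: "\<not> p - 1 dvd l" using l' by (auto dest: dvd_imp_le)
    have nd: "\<not> p - 1 dvd m" using ndl ml cong_dvd_iff by blast
    have "\<not> p dvd l" using l' by (auto dest: dvd_imp_le)
    hence "int p dvd num (bernoulli m)"
      using prime_squared_dvd_power_sum_cong[OF assms(1) ml nd assms(4) l'(2) ndvd[OF pm1]]
        l' assms irregular_pair_ge_5[OF l(1)] by (simp add: prime_dvd_num_bernoulli_iff)
    thus "int p dvd gcd (num (bernoulli m / of_nat m)) (int m - 1)"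
      using pm1 m1 num_iff ndvd by simp
  qed
qed

section \<open>Congruences to non-coprime moduli\<close>

text \<open>On the exponents of each prime, min(n, max(a, b)) equals min(n, a) or min(n, b).\<close>

lemma gcd_lcm_dvd:
  fixes n a b y :: int
  assumes "gcd n a dvd y" "gcd n b dvd y" "n \<noteq> 0" "a \<noteq> 0" "b \<noteq> 0"
  shows "gcd n (lcm a b) dvd y"
proof (cases "y = 0")
  case False
  show ?thesis
  proof (rule multiplicity_le_imp_dvd)
    fix q :: int assume q: "prime q"
    have "multiplicity q (gcd n a) \<le> multiplicity q y" "multiplicity q (gcd n b) \<le> multiplicity q y"
      using assms False q by (auto intro!: dvd_imp_multiplicity_le)
    thus "multiplicity q (gcd n (lcm a b)) \<le> multiplicity q y"
      using assms q by (simp add: multiplicity_gcd multiplicity_lcm lcm_eq_0_iff)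
  qed (use assms in auto)
qed auto

lemma gcd_Lcm_dvd:
  fixes n y :: int and M :: "int set"
  assumes "finite M" "\<And>k. k \<in> M \<Longrightarrow> gcd n k dvd y" "n \<noteq> 0" "0 \<notin> M"
  shows "gcd n (Lcm M) dvd y"
  using assms
proof (induction M rule: finite_induct)
  case (insert k M)
  hence "Lcm M \<noteq> 0" by (simp add: Lcm_0_iff)
  thus ?case using insert by (auto intro!: gcd_lcm_dvd)
qed auto

text \<open>A solution x for the earlier moduli is corrected by a multiple of their lcm
  \<open>?L\<close>. The required multiple exists because gcd (m i) \<open>?L\<close> divides a i -
  x, which \<open>gcd_Lcm_dvd\<close> reduces to pairwise compatibility.\<close>

lemma chinese_remainder_compatible:
  fixes a m :: "'i \<Rightarrow> int"
  assumes "finite I" "\<And>i. i \<in> I \<Longrightarrow> m i \<noteq> 0"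
    "\<And>i j. i \<in> I \<Longrightarrow> j \<in> I \<Longrightarrow> [a i = a j] (mod gcd (m i) (m j))"
  shows "\<exists>x. \<forall>i\<in>I. [x = a i] (mod m i)"
  using assms
proof (induction I rule: finite_induct)
  case (insert i I)
  then obtain x where x: "\<forall>j\<in>I. [x = a j] (mod m j)" by auto
  let ?L = "Lcm (m ` I)"
  have "gcd (m i) (m j) dvd a i - x" if "j \<in> I" for j
  proof -
    have "[a i = a j] (mod gcd (m i) (m j))" using insert.prems(2) that by blast
    moreover have "[x = a j] (mod gcd (m i) (m j))"
      using x that by (meson cong_dvd_modulus gcd_dvd2)
    ultimately show ?thesis by (meson cong_iff_dvd_diff cong_sym cong_trans)
  qed
  hence "gcd (m i) ?L dvd a i - x"
    using insert.hyps insert.prems(1) by (intro gcd_Lcm_dvd) force+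
  then obtain t where t: "[?L * t = a i - x] (mod m i)"
    using cong_solve_dvd_int[of ?L "m i" "a i - x"] by (auto simp: gcd.commute)
  have "[x + ?L * t = a i] (mod m i)"
    using cong_add[OF cong_refl[of x] t] by simp
  moreover have "[x + ?L * t = a j] (mod m j)" if "j \<in> I" for j
  proof -
    have "m j dvd ?L * t" using that by (simp add: dvd_Lcm)
    hence "[x + ?L * t = x + 0] (mod m j)"
      by (intro cong_add) (auto simp: cong_0_iff)
    thus ?thesis using x that cong_trans by fastforce
  qed
  ultimately show ?case by auto
qed auto

lemma prod_primes_dvd:
  assumes "finite P" "\<And>p. p \<in> P \<Longrightarrow> prime p" "\<And>p. p \<in> P \<Longrightarrow> p dvd n"
  shows "\<Prod>P dvd (n :: nat)"
  using assms
proof (induction P rule: finite_induct)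
  case (insert p P)
  have "coprime p (\<Prod>P)"
  proof (rule prod_coprime_right)
    fix q assume "q \<in> P"
    thus "coprime p q" using insert.hyps insert.prems(1) by (intro primes_coprime) auto
  qed
  thus ?case using insert by (auto intro: divides_mult)
qed auto

section \<open>Simultaneous congruences for a family of irregular pairs\<close>

text \<open>Here x plays the role of m - 1. The interval bounds of \<open>mS_cond\<close> are left
  out so that solutions of any size can be compared.\<close>

definition solves :: "nat set \<Rightarrow> (nat \<Rightarrow> nat) \<Rightarrow> nat \<Rightarrow> bool" where
  "solves P l x \<longleftrightarrow> (\<forall>p\<in>P. [x = p * (l p - 1)] (mod p * (p - 1)))"

lemma solves_iff:
  assumes "\<And>p. p \<in> P \<Longrightarrow> irregular_pair p (l p)"
  shows "solves P l x \<longleftrightarrow> (\<forall>p\<in>P. p dvd x \<and> [x + 1 = l p] (mod p - 1))"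
  unfolding solves_def
proof (intro ball_cong refl)
  fix p assume "p \<in> P"
  hence "prime p" "l p > 0" using assms[of p] by (auto simp: irregular_pair_def)
  thus "[x = p * (l p - 1)] (mod p * (p - 1)) \<longleftrightarrow> p dvd x \<and> [x + 1 = l p] (mod p - 1)"
    by (rule cong_pair_iff)
qed

locale irregular_pairs =
  fixes P :: "nat set" and l :: "nat \<Rightarrow> nat"
  assumes finite_P: "finite P" and P_nonempty: "P \<noteq> {}"
    and irregular: "p \<in> P \<Longrightarrow> irregular_pair p (l p)"
begin

definition modulus :: nat where
  "modulus = lcm (\<Prod>P) (Lcm ((\<lambda>p. p - 1) ` P))"

lemma prime_P: "p \<in> P \<Longrightarrow> prime p"
  using irregular by (auto simp: irregular_pair_def)

lemma modulus_pos: "modulus > 0"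
proof -
  have "p - 1 \<noteq> 0" if "p \<in> P" for p using prime_gt_1_nat[OF prime_P[OF that]] by simp
  hence "Lcm ((\<lambda>p. p - 1) ` P) \<noteq> 0" using finite_P by (auto simp: Lcm_0_iff)
  moreover have "\<Prod>P \<noteq> 0" using finite_P prime_P[of 0] by auto
  ultimately show ?thesis unfolding modulus_def by (auto intro: Nat.gr0I)
qed

lemma solves_dvd: "solves P l x \<Longrightarrow> p \<in> P \<Longrightarrow> p dvd x"
  and solves_cong: "solves P l x \<Longrightarrow> p \<in> P \<Longrightarrow> [x + 1 = l p] (mod p - 1)"
  using solves_iff[of P l x] irregular by auto

text \<open>Both p - 1 and l p are even, so x + 1 is even. This is what rules out x = 0.\<close>

lemma solves_odd:
  assumes "solves P l x" shows "odd x"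
proof -
  obtain p where p: "p \<in> P" using P_nonempty by blast
  have "even (p - 1)" "even (l p)" using irregular[OF p] by (auto simp: irregular_pair_def)
  moreover have "[x + 1 = l p] (mod 2)"
    using cong_dvd_modulus_nat[OF solves_cong[OF assms p] \<open>even (p - 1)\<close>] .
  ultimately have "even (x + 1)" using cong_dvd_iff by blast
  thus ?thesis by simp
qed

lemma solves_ge:
  assumes "solves P l x" shows "\<Prod>P \<le> x"
  using prod_primes_dvd[OF finite_P prime_P solves_dvd[OF assms]] odd_pos[OF solves_odd[OF assms]]
  by (simp add: dvd_imp_le)

lemma solves_unique:
  assumes "solves P l x" "solves P l y" "x \<le> modulus" "y \<le> modulus"
  shows "x = y"
proof -
  have aux: "x = y" if xy: "solves P l x" "solves P l y" "y \<le> modulus" "x \<le> y" for x y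
  proof -
    have "\<Prod>P dvd y - x"
      using xy solves_dvd by (intro prod_primes_dvd finite_P prime_P dvd_diff_nat) auto
    moreover have "p - 1 dvd y - x" if p: "p \<in> P" for p
    proof -
      have "[x + 1 = y + 1] (mod p - 1)"
        using solves_cong[OF xy(1) p] solves_cong[OF xy(2) p] cong_sym cong_trans by blast
      hence "[y = x] (mod p - 1)" by (simp only: cong_add_rcancel_nat cong_sym_eq)
      thus ?thesis using xy(4) by (simp add: cong_altdef_nat)
    qed
    ultimately have "modulus dvd y - x"
      unfolding modulus_def by (auto intro!: lcm_least Lcm_least)
    \<comment> \<open>Oddness gives x > 0, so the closed upper bound still leaves a difference below
      one period.\<close>
    moreover have "y - x < modulus"
      using xy(3) odd_pos[OF solves_odd[OF xy(1)]] modulus_pos by linarith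
    ultimately show ?thesis using xy(4) by (auto dest: dvd_imp_le)
  qed
  show ?thesis using aux[of x y] aux[of y x] assms by (cases "x \<le> y") auto
qed

text \<open>Friendliness compares two congruences for x + 1 modulo the gcd. If q divides p - 1, then
  modulo q both x + 1 = l p and x = 0 hold.\<close>

lemma strong_friendly_of_solves:
  assumes "solves P l x"
  shows "strong_friendly P l"
  unfolding strong_friendly_def friendly_def
proof (intro conjI ballI impI)
  fix p q assume pq: "p \<in> P" "q \<in> P" "p \<noteq> q"
  note cp = solves_cong[OF assms pq(1)] and cq = solves_cong[OF assms pq(2)]
  show "[l p = l q] (mod gcd (p - 1) (q - 1))"
    using cong_dvd_modulus_nat[OF cp gcd_dvd1] cong_dvd_modulus_nat[OF cq gcd_dvd2]
      cong_sym cong_trans by blast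
  have "[l p = 1] (mod q)" if "[p = 1] (mod q)"
  proof -
    have "q dvd p - 1"
      using that prime_gt_0_nat[OF prime_P[OF pq(1)]] by (simp add: cong_altdef_nat)
    hence "[x + 1 = l p] (mod q)" using cong_dvd_modulus_nat[OF cp] by blast
    moreover have "[x + 1 = 1] (mod q)"
      using solves_dvd[OF assms pq(2)] by (auto simp: cong_altdef_nat)
    ultimately show ?thesis using cong_sym cong_trans by blast
  qed
  thus "\<not> [p = 1] (mod q) \<or> ([p = 1] (mod q) \<and> [l p = 1] (mod q))" by blast
qed

lemma solves_exists:
  assumes "strong_friendly P l"
  obtains x where "solves P l x" "x \<le> modulus"
proof -
  \<comment> \<open>Each prime contributes two congruences: index (p, True) stands for x = 0 modulo
    p, and (p, False) for x = l p - 1 modulo p - 1.\<close>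
  define m :: "nat \<times> bool \<Rightarrow> int" where "m = (\<lambda>(p, b). if b then int p else int (p - 1))"
  define a :: "nat \<times> bool \<Rightarrow> int" where "a = (\<lambda>(p, b). if b then 0 else int (l p) - 1)"
  \<comment> \<open>Compatibility of a modulus p with a modulus q - 1: either p divides q - 1 and
    the strong condition applies, or the gcd is 1. The case p = q is of the second kind.\<close>
  have mixed: "[0 = int (l q) - 1] (mod gcd (int p) (int (q - 1)))" if pq: "p \<in> P" "q \<in> P" for p q
  proof (cases "p dvd q - 1")
    case True
    have "p \<noteq> q" using True prime_gt_1_nat[OF prime_P[OF pq(1)]] by (auto dest: dvd_imp_le)
    moreover have "[q = 1] (mod p)"
      using True prime_gt_0_nat[OF prime_P[OF pq(2)]] by (simp add: cong_altdef_nat)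
    ultimately have "[l q = 1] (mod p)"
      using bspec[OF bspec[OF conjunct2[OF assms[unfolded strong_friendly_def]] pq(2)] pq(1)] by blast
    hence "[int (l q) = int 1] (mod int p)" by (simp only: cong_int_iff)
    hence "int p dvd int (l q) - 1" by (simp add: cong_iff_dvd_diff)
    hence "[0 = int (l q) - 1] (mod int p)" by (simp only: cong_sym_eq[of 0] cong_0_iff)
    thus ?thesis by (rule cong_dvd_modulus) simp
  next
    case False
    hence "gcd (int p) (int (q - 1)) = 1"
      using prime_imp_coprime[OF prime_P[OF pq(1)] False] by (metis coprime_iff_gcd_eq_1 coprime_int_iff)
    thus ?thesis by simp
  qed
  have "\<exists>x. \<forall>i\<in>P \<times> UNIV. [x = a i] (mod m i)"
  proof (rule chinese_remainder_compatible)
    show "finite (P \<times> (UNIV :: bool set))" using finite_P by simp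
    show "m i \<noteq> 0" if "i \<in> P \<times> UNIV" for i
    proof -
      obtain p b where "i = (p, b)" "p \<in> P" using \<open>i \<in> P \<times> UNIV\<close> by auto
      thus ?thesis using prime_gt_1_nat[OF prime_P[of p]] by (simp add: m_def)
    qed
    fix i j assume "i \<in> P \<times> (UNIV :: bool set)" "j \<in> P \<times> (UNIV :: bool set)"
    then obtain p b q b' where ij: "i = (p, b)" "j = (q, b')" "p \<in> P" "q \<in> P" by auto
    have friendly: "[int (l p) - 1 = int (l q) - 1] (mod gcd (int (p - 1)) (int (q - 1)))"
    proof (cases "p = q")
      case False
      hence "[l p = l q] (mod gcd (p - 1) (q - 1))"
        using bspec[OF bspec[OF conjunct1[OF assms[unfolded strong_friendly_def friendly_def]] ij(3)] ij(4)]
        by blast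
      hence "[int (l p) = int (l q)] (mod gcd (int (p - 1)) (int (q - 1)))"
        by (metis cong_int_iff gcd_int_int_eq)
      thus ?thesis by (intro cong_diff) auto
    qed auto
    show "[a i = a j] (mod gcd (m i) (m j))"
      using friendly mixed[OF ij(3,4)] mixed[OF ij(4,3)] unfolding ij m_def a_def
      by (cases b; cases b') (auto simp: gcd.commute cong_sym)
  qed
  then obtain x0 where x0: "\<forall>i\<in>P \<times> UNIV. [x0 = a i] (mod m i)" by blast
  \<comment> \<open>Every p and p - 1 divides \<open>modulus\<close>, so reduction preserves all the
    congruences.\<close>
  define x where "x = nat (x0 mod int modulus)"
  have x: "int x = x0 mod int modulus" using modulus_pos by (simp add: x_def)
  have cong: "[int x = x0] (mod int k)" if "k dvd modulus" for k
    unfolding x using that by (simp add: cong_def mod_mod_cancel)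
  have "p dvd x \<and> [x + 1 = l p] (mod p - 1)" if p: "p \<in> P" for p
  proof
    have "p dvd \<Prod>P" using p finite_P by (rule dvd_prodI[rotated])
    hence "p dvd modulus" unfolding modulus_def by (rule dvd_lcmI1)
    moreover have "[x0 = 0] (mod int p)" using bspec[OF x0, of "(p, True)"] p by (simp add: a_def m_def)
    ultimately have "[int x = 0] (mod int p)" using cong cong_trans by blast
    thus "p dvd x" by (simp add: cong_0_iff)
    have "p - 1 dvd Lcm ((\<lambda>p. p - 1) ` P)" using p by (intro dvd_Lcm) auto
    hence "p - 1 dvd modulus" unfolding modulus_def by (rule dvd_lcmI2)
    moreover have "[x0 = int (l p) - 1] (mod int (p - 1))"
      using bspec[OF x0, of "(p, False)"] p by (simp add: a_def m_def)
    ultimately have "[int x = int (l p) - 1] (mod int (p - 1))"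
      using cong cong_trans by blast
    hence "[int x + 1 = int (l p) - 1 + 1] (mod int (p - 1))" by (intro cong_add) auto
    hence "[int (x + 1) = int (l p)] (mod int (p - 1))" by (simp add: add.commute)
    thus "[x + 1 = l p] (mod p - 1)" by (simp only: cong_int_iff)
  qed
  hence "solves P l x" using solves_iff[of P l x] irregular by blast
  moreover have "x \<le> modulus"
    using modulus_pos pos_mod_bound[of "int modulus" x0] x by linarith
  ultimately show ?thesis using that by blast
qed

lemma mS_cond_iff: "mS_cond P l m \<longleftrightarrow> 1 \<le> m \<and> m - 1 \<le> modulus \<and> solves P l (m - 1)"
  unfolding mS_cond_def modulus_def[symmetric] using solves_ge by (auto simp: solves_def)

lemma mS_ex1:
  assumes "strong_friendly P l"
  shows "\<exists>!m. mS_cond P l m"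
proof -
  obtain x where x: "solves P l x" "x \<le> modulus" using solves_exists[OF assms] .
  show ?thesis
  proof (rule ex1I[of _ "x + 1"])
    show "mS_cond P l (x + 1)" using x by (simp add: mS_cond_iff)
    fix m assume "mS_cond P l m"
    thus "m = x + 1" using solves_unique[OF x(1) _ x(2), of "m - 1"] by (auto simp: mS_cond_iff)
  qed
qed

text \<open>A solution inside the interval coincides with m by uniqueness, and one beyond it is
  larger anyway.\<close>

lemma mS_minimal:
  assumes "mS_cond P l m" "solves P l (k - 1)" "k \<ge> 1"
  shows "m \<le> k"
proof (cases "k - 1 \<le> modulus")
  case True
  hence "mS_cond P l k" using assms by (simp add: mS_cond_iff)
  thus ?thesis
    using assms mS_ex1[OF strong_friendly_of_solves[OF assms(2)]] by auto
next
  case False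
  thus ?thesis using assms(1) unfolding mS_cond_iff by linarith
qed

end

section \<open>From the ratio condition to the minimum over strong friendly sets\<close>

lemma lambda_cond_iff:
  assumes "finite P" "P \<noteq> {}" "\<And>p. p \<in> P \<Longrightarrow> prime p \<and> odd p"
  shows "lambda_cond (\<Prod>P) m \<longleftrightarrow>
    (\<exists>l. (\<forall>p\<in>P. irregular_pair p (l p)) \<and> m \<ge> 1 \<and> solves P l (m - 1))"
proof (cases "even m \<and> m \<ge> 2")
  case True
  let ?g = "gcd (num (bernoulli m / of_nat m)) (int m - 1)"
  have "bernoulli m / of_nat m \<noteq> 0" using bernoulli_even_nonzero[of m] True by auto
  hence "num (bernoulli m / of_nat m) div num (bernoulli m / of_nat m / of_int (int m - 1)) = ?g"
    using True by (intro num_div_num_divide) auto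
  hence "lambda_cond (\<Prod>P) m \<longleftrightarrow> int (\<Prod>P) dvd ?g"
    using True by (simp add: lambda_cond_def cong_0_iff)
  also have "\<dots> \<longleftrightarrow> \<Prod>P dvd nat ?g"
    by (metis gcd_ge_0_int int_dvd_int_iff nat_0_le)
  also have "\<dots> \<longleftrightarrow> (\<forall>p\<in>P. p dvd nat ?g)"
    using assms prod_primes_dvd[of P "nat ?g"] by (auto intro: dvd_trans[OF dvd_prodI])
  also have "\<dots> \<longleftrightarrow> (\<forall>p\<in>P. int p dvd ?g)"
    by (metis gcd_ge_0_int int_dvd_int_iff nat_0_le)
  also have "\<dots> \<longleftrightarrow> (\<forall>p\<in>P. \<exists>l. irregular_pair p l \<and> [m - 1 = p * (l - 1)] (mod p * (p - 1)))"
    using True assms(3) by (intro ball_cong refl prime_dvd_ratio_iff) auto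
  \<comment> \<open>The primes choose their pairs independently; friendliness is not imposed but
    follows from the common m.\<close>
  also have "\<dots> \<longleftrightarrow> (\<exists>l. \<forall>p\<in>P. irregular_pair p (l p) \<and> [m - 1 = p * (l p - 1)] (mod p * (p - 1)))"
    by (rule bchoice_iff)
  finally show ?thesis using True unfolding solves_def by auto
next
  case False
  \<comment> \<open>Both sides fail here: a solution m - 1 is odd, which also excludes m =
    1.\<close>
  have "even m \<and> m \<ge> 2"
    if "\<forall>p\<in>P. irregular_pair p (l p)" "m \<ge> 1" "solves P l (m - 1)" for l
  proof -
    interpret irregular_pairs P l using assms that by unfold_locales auto
    have "odd (m - 1)" using solves_odd that by blast
    thus ?thesis using that(2) by (cases "m = 1") auto
  qed
  thus ?thesis using False by (auto simp: lambda_cond_def)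
qed

theorem theorem4p5:
  fixes P :: "nat set" and c :: nat
  assumes "finite P" and "card P \<ge> 2"
    and "\<forall>p\<in>P. prime p \<and> irregular_prime p"
    and "c = \<Prod>P"
  shows "((\<exists>m. lambda_cond c m) \<longrightarrow> (\<exists>l. strong_friendly_irregular P l))
    \<and> (\<forall>l. strong_friendly_irregular P l \<longrightarrow> (\<exists>!m. mS_cond P l m))
    \<and> Lambda c = (INF l\<in>{l. strong_friendly_irregular P l}. enat (THE m. mS_cond P l m))"
proof -
  have ne: "P \<noteq> {}" using assms(2) by auto
  have pairs: "irregular_pairs P l" if "\<forall>p\<in>P. irregular_pair p (l p)" for l
    using assms(1) ne that by unfold_locales auto
  have cond: "lambda_cond c m \<longleftrightarrow> (\<exists>l. strong_friendly_irregular P l \<and> m \<ge> 1 \<and> solves P l (m - 1))" for m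
  proof -
    have "lambda_cond c m \<longleftrightarrow> (\<exists>l. (\<forall>p\<in>P. irregular_pair p (l p)) \<and> m \<ge> 1 \<and> solves P l (m - 1))"
      unfolding assms(4) using assms(1,3) ne
      by (intro lambda_cond_iff) (auto simp: irregular_prime_def irregular_pair_def)
    thus ?thesis
      using irregular_pairs.strong_friendly_of_solves[OF pairs]
      unfolding strong_friendly_irregular_def by blast
  qed
  have ex1: "\<exists>!m. mS_cond P l m" if "strong_friendly_irregular P l" for l
    using irregular_pairs.mS_ex1[OF pairs] that unfolding strong_friendly_irregular_def by blast
  let ?m = "\<lambda>l. THE m. mS_cond P l m"
  have mS: "mS_cond P l (?m l)" if "strong_friendly_irregular P l" for l
    using theI'[OF ex1[OF that]] .
  \<comment> \<open>The functions l may differ outside P without affecting \<open>mS_cond\<close>,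
    so each set of pairs is merely repeated. An empty index set gives infinity, the value of
    \<open>Lambda\<close> when there is no solution.\<close>
  have "Lambda c = (INF l\<in>{l. strong_friendly_irregular P l}. enat (?m l))"
  proof (rule antisym)
    show "Lambda c \<le> (INF l\<in>{l. strong_friendly_irregular P l}. enat (?m l))"
    proof (rule INF_greatest)
      fix l assume "l \<in> {l. strong_friendly_irregular P l}"
      hence l: "strong_friendly_irregular P l" by simp
      hence "irregular_pairs P l" using pairs by (simp add: strong_friendly_irregular_def)
      hence "lambda_cond c (?m l)"
        using l mS[OF l] irregular_pairs.mS_cond_iff unfolding cond by blast
      thus "Lambda c \<le> enat (?m l)" by (auto simp: Lambda_def intro: Least_le)
    qed
    show "(INF l\<in>{l. strong_friendly_irregular P l}. enat (?m l)) \<le> Lambda c"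
    proof (cases "\<exists>m. lambda_cond c m")
      case True
      let ?k = "LEAST m. lambda_cond c m"
      have "lambda_cond c ?k" using True by (rule LeastI_ex)
      \<comment> \<open>The least solution determines its own strong friendly set, whose m_S cannot
        exceed it.\<close>
      then obtain l where l: "strong_friendly_irregular P l" "?k \<ge> 1" "solves P l (?k - 1)"
        unfolding cond by blast
      have "?m l \<le> ?k"
        using irregular_pairs.mS_minimal[OF pairs mS[OF l(1)] l(3,2)] l(1)
        by (simp add: strong_friendly_irregular_def)
      hence "enat (?m l) \<le> Lambda c" using True by (simp add: Lambda_def)
      thus ?thesis using l(1) by (intro INF_lower2[of l]) auto
    qed (simp add: Lambda_def)
  qed
  thus ?thesis using cond ex1 by blast
qed

end
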